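(* Let $n\geq 6$ and $1\leq \ell\leq \lfloor\frac{n}{2}\rfloor$ be integers. Then $$ f(n;\overline{\kappa}_n\leq \ell)=g(n;\overline{\lambda}_n\leq \ell)=\begin{cases} \binom{n-1}{2}+\ell, & \text{if } 1\leq \ell\leq \lfloor\frac{n-4}{2}\rfloor, \text{ or } \ell=\lfloor\frac{n-2}{2}\rfloor \text{ and } n \text{ is odd};\\ \binom{n-1}{2}+2\ell, & \text{if } \ell=\lfloor\frac{n-2}{2}\rfloor \text{ and } n \text{ is even};\\ \binom{n}{2}, & \text{if } \ell=\lfloor\frac{n}{2}\rfloor. \end{cases} $$
   Context: All graphs are finite, simple and undirected; $e(G)$ is the number of edges of $G$. For a graph $G$ and $S\subseteq V(G)$ with $|S|\geq 2$, a tree connecting $S$ is a subgraph of $G$ that is a tree whose vertex set contains $S$. Two trees $T,T'$ connecting $S$ are internally disjoint if $E(T)\cap E(T')=\varnothing$ and $V(T)\cap V(T')=S$. Let $\kappa(S)$ (resp. $\lambda(S)$) be the maximum number of pairwise internally disjoint (resp. pairwise edge-disjoint) trees connecting $S$ in $G$. For $2\leq k\leq |V(G)|$, $\overline{\kappa}_k(G)=\max\{\kappa(S): S\subseteq V(G),\ |S|=k\}$ and $\overline{\lambda}_k(G)=\max\{\lambda(S): S\subseteq V(G),\ |S|=k\}$. Define $f(n;\overline{\kappa}_k\leq \ell)=\max\{e(G): |V(G)|=n,\ \overline{\kappa}_k(G)\leq \ell\}$ and $g(n;\overline{\lambda}_k\leq \ell)=\max\{e(G): |V(G)|=n,\ \overline{\lambda}_k(G)\leq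 \ell\}$. *)

theory Defs
  imports Main
begin

text \<open>
  The graphs of the library theories are digraphs, in which a symmetric pair of arcs already
  forms a cycle; trees of an undirected graph are therefore defined here directly, with edges
  as two-element sets of vertices.
\<close>

record 'a ugraph =
  verts :: "'a set"
  edges :: "'a set set"

definition simple_graph :: "'a ugraph \<Rightarrow> bool" where
  "simple_graph G \<longleftrightarrow> finite (verts G) \<and> (\<forall>e \<in> edges G. e \<subseteq> verts G \<and> card e = 2)"

definition is_subgraph :: "'a ugraph \<Rightarrow> 'a ugraph \<Rightarrow> bool" where
  "is_subgraph H G \<longleftrightarrow> simple_graph H \<and> verts H \<subseteq> verts G \<and> edges H \<subseteq> edges G"

definition connected_graph :: "'a ugraph \<Rightarrow> bool" where
  "connected_graph G \<longleftrightarrow> verts G \<noteq> {} \<and>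
     (\<forall>u \<in> verts G. \<forall>v \<in> verts G. (u, v) \<in> {(x, y). {x, y} \<in> edges G}\<^sup>*)"

text \<open>A cycle is given by its vertices in cyclic order, without repeating the first one.\<close>

definition is_cycle :: "'a ugraph \<Rightarrow> 'a list \<Rightarrow> bool" where
  "is_cycle G vs \<longleftrightarrow> length vs \<ge> 3 \<and> distinct vs \<and>
     (\<forall>i < length vs. {vs ! i, vs ! (Suc i mod length vs)} \<in> edges G)"

definition is_tree :: "'a ugraph \<Rightarrow> bool" where
  "is_tree T \<longleftrightarrow> simple_graph T \<and> connected_graph T \<and> (\<nexists>vs. is_cycle T vs)"

definition trees_connecting :: "'a ugraph \<Rightarrow> 'a set \<Rightarrow> 'a ugraph set" where
  "trees_connecting G S = {T. is_subgraph T G \<and> is_tree T \<and> S \<subseteq> verts T}"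

definition edge_disjoint :: "'a ugraph \<Rightarrow> 'a ugraph \<Rightarrow> bool" where
  "edge_disjoint T T' \<longleftrightarrow> edges T \<inter> edges T' = {}"

definition internally_disjoint :: "'a set \<Rightarrow> 'a ugraph \<Rightarrow> 'a ugraph \<Rightarrow> bool" where
  "internally_disjoint S T T' \<longleftrightarrow> edges T \<inter> edges T' = {} \<and> verts T \<inter> verts T' = S"

text \<open>
  As \<open>|S| \<ge> 2\<close>, a tree connecting \<open>S\<close> has an edge, so it is not disjoint from itself in either
  sense and collections of pairwise disjoint trees are sets.
\<close>

definition kappa :: "'a ugraph \<Rightarrow> 'a set \<Rightarrow> nat" where
  "kappa G S = Max {card \<T> | \<T>. \<T> \<subseteq> trees_connecting G S \<and> pairwise (internally_disjoint S) \<T>}"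

definition lambda :: "'a ugraph \<Rightarrow> 'a set \<Rightarrow> nat" where
  "lambda G S = Max {card \<T> | \<T>. \<T> \<subseteq> trees_connecting G S \<and> pairwise edge_disjoint \<T>}"

definition kappa_bar :: "nat \<Rightarrow> 'a ugraph \<Rightarrow> nat" where
  "kappa_bar k G = Max {kappa G S | S. S \<subseteq> verts G \<and> card S = k}"

definition lambda_bar :: "nat \<Rightarrow> 'a ugraph \<Rightarrow> nat" where
  "lambda_bar k G = Max {lambda G S | S. S \<subseteq> verts G \<and> card S = k}"

text \<open>
  Every finite graph is isomorphic to one whose vertices are natural numbers, so the extremal
  numbers range over those. The arguments are the order \<open>n\<close>, then \<open>k\<close>, then the bound \<open>l\<close>.
\<close>

definition f_max :: "nat \<Rightarrow> nat \<Rightarrow> nat \<Rightarrow> nat" where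
  "f_max n k l = Max {card (edges G) | G :: nat ugraph.
     simple_graph G \<and> card (verts G) = n \<and> kappa_bar k G \<le> l}"

definition g_max :: "nat \<Rightarrow> nat \<Rightarrow> nat \<Rightarrow> nat" where
  "g_max n k l = Max {card (edges G) | G :: nat ugraph.
     simple_graph G \<and> card (verts G) = n \<and> lambda_bar k G \<le> l}"

text \<open>All maxima above are taken over finite nonempty sets.\<close>

lemma finite_trees_connecting:
  assumes "simple_graph G" shows "finite (trees_connecting G S)"
proof -
  have fe: "finite (edges G)"
    using assms by (auto simp: simple_graph_def intro: finite_subset[of _ "Pow (verts G)"])
  have "trees_connecting G S \<subseteq>
      (\<lambda>(V, E). \<lparr>verts = V, edges = E\<rparr>) ` (Pow (verts G) \<times> Pow (edges G))"
  proof
    fix T assume "T \<in> trees_connecting G S"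
    hence "T = (\<lambda>(V, E). \<lparr>verts = V, edges = E\<rparr>) (verts T, edges T)"
      "(verts T, edges T) \<in> Pow (verts G) \<times> Pow (edges G)"
      by (simp_all add: trees_connecting_def is_subgraph_def)
    thus "T \<in> (\<lambda>(V, E). \<lparr>verts = V, edges = E\<rparr>) ` (Pow (verts G) \<times> Pow (edges G))"
      by (rule image_eqI)
  qed
  moreover have "finite (Pow (verts G) \<times> Pow (edges G))"
    using assms fe by (simp add: simple_graph_def)
  ultimately show ?thesis by (rule finite_subset[OF _ finite_imageI])
qed

lemma packing_sizes_finite_nonempty:
  assumes "simple_graph G"
  shows "finite {card \<T> | \<T>. \<T> \<subseteq> trees_connecting G S \<and> pairwise R \<T>}"
    and "{card \<T> | \<T>. \<T> \<subseteq> trees_connecting G S \<and> pairwise R \<T>} \<noteq> {}"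
proof -
  have "{card \<T> | \<T>. \<T> \<subseteq> trees_connecting G S \<and> pairwise R \<T>}
      \<subseteq> card ` Pow (trees_connecting G S)" by auto
  thus "finite {card \<T> | \<T>. \<T> \<subseteq> trees_connecting G S \<and> pairwise R \<T>}"
    by (rule finite_subset) (simp add: finite_trees_connecting[OF assms])
  show "{card \<T> | \<T>. \<T> \<subseteq> trees_connecting G S \<and> pairwise R \<T>} \<noteq> {}"
    using pairwise_empty by blast
qed

lemma bar_values_finite_nonempty:
  assumes "simple_graph G" "k \<le> card (verts G)"
  shows "finite {F S | S. S \<subseteq> verts G \<and> card S = k}"
    and "{F S | S. S \<subseteq> verts G \<and> card S = k} \<noteq> {}"
proof -
  have "{F S | S. S \<subseteq> verts G \<and> card S = k} \<subseteq> F ` Pow (verts G)" by auto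
  thus "finite {F S | S. S \<subseteq> verts G \<and> card S = k}"
    by (rule finite_subset) (use assms(1) in \<open>simp add: simple_graph_def\<close>)
  show "{F S | S. S \<subseteq> verts G \<and> card S = k} \<noteq> {}"
  proof -
    obtain S where "S \<subseteq> verts G" "card S = k"
      by (rule obtain_subset_with_card_n[OF assms(2)])
    hence "F S \<in> {F S | S. S \<subseteq> verts G \<and> card S = k}" by auto
    thus ?thesis by blast
  qed
qed

lemma edge_counts_finite:
  "finite {card (edges G) | G :: nat ugraph. simple_graph G \<and> card (verts G) = n \<and> P G}"
proof (rule finite_subset)
  show "{card (edges G) | G :: nat ugraph. simple_graph G \<and> card (verts G) = n \<and> P G} \<subseteq> {..2 ^ n}"
  proof
    fix m assume "m \<in> {card (edges G) | G :: nat ugraph. simple_graph G \<and> card (verts G) = n \<and> P G}"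
    then obtain G :: "nat ugraph" where G: "m = card (edges G)" "simple_graph G" "card (verts G) = n"
      by blast
    have "edges G \<subseteq> Pow (verts G)" "finite (verts G)"
      using G(2) by (auto simp: simple_graph_def)
    hence "card (edges G) \<le> 2 ^ card (verts G)"
      by (metis card_Pow card_mono finite_Pow_iff)
    thus "m \<in> {..2 ^ n}"
      by (simp add: G)
  qed
qed simp

lemma no_trees_in_edgeless_graph:
  assumes "edges G = {}" "card S \<ge> 2" shows "trees_connecting G S = {}"
proof (rule ccontr)
  assume "trees_connecting G S \<noteq> {}"
  then obtain T where T: "is_subgraph T G" "is_tree T" "S \<subseteq> verts T"
    by (auto simp: trees_connecting_def)
  have "edges T = {}" using T(1) assms(1) by (simp add: is_subgraph_def)
  moreover obtain u v where "u \<in> S" "v \<in> S" "u \<noteq> v"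
    by (metis obtain_subset_with_card_n[OF assms(2)] card_2_iff insert_subset)
  moreover from this have "(u, v) \<in> {(x, y). {x, y} \<in> edges T}\<^sup>*"
    using T(2,3) unfolding is_tree_def connected_graph_def by blast
  ultimately show False by simp
qed

lemma edge_counts_nonempty:
  assumes "2 \<le> k" "k \<le> n"
  shows "{card (edges G) | G :: nat ugraph. simple_graph G \<and> card (verts G) = n \<and> kappa_bar k G \<le> l} \<noteq> {}"
    and "{card (edges G) | G :: nat ugraph. simple_graph G \<and> card (verts G) = n \<and> lambda_bar k G \<le> l} \<noteq> {}"
proof -
  define G :: "nat ugraph" where "G = \<lparr>verts = {..<n}, edges = {}\<rparr>"
  have G: "simple_graph G" "card (verts G) = n" "edges G = {}"
    by (auto simp: G_def simple_graph_def)
  have 0: "kappa G S = 0" "lambda G S = 0" if "card S = k" for S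
  proof -
    have "trees_connecting G S = {}"
      using no_trees_in_edgeless_graph[OF G(3)] that assms by simp
    hence "{card \<T> | \<T>. \<T> \<subseteq> trees_connecting G S \<and> pairwise R \<T>} = {0}" for R
      by (simp add: conj_commute cong: conj_cong)
    thus "kappa G S = 0" "lambda G S = 0" by (simp_all only: kappa_def lambda_def Max_singleton)
  qed
  have "k \<le> card (verts G)" using G(2) assms by simp
  note bar = bar_values_finite_nonempty[OF G(1) this]
  have "kappa_bar k G \<le> l"
    unfolding kappa_bar_def by (rule Max.boundedI[OF bar]) (auto simp: 0)
  moreover have "lambda_bar k G \<le> l"
    unfolding lambda_bar_def by (rule Max.boundedI[OF bar]) (auto simp: 0)
  ultimately show
    "{card (edges G) | G :: nat ugraph. simple_graph G \<and> card (verts G) = n \<and> kappa_bar k G \<le> l} \<noteq> {}"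
    "{card (edges G) | G :: nat ugraph. simple_graph G \<and> card (verts G) = n \<and> lambda_bar k G \<le> l} \<noteq> {}"
    using G(1,2) by (metis (mono_tags, lifting) empty_Collect_eq)+
qed

end

theory Submission
  imports Defs
begin

text \<open>
  For \<open>k = n\<close> both invariants are the maximal number of edge-disjoint spanning trees. Upper bounds
  for it come from a vertex of small degree or from counting edges. The other direction says
  that deleting \<open>n - 1 - k\<close> arbitrary edges from \<open>K\<^sub>n\<close> leaves \<open>k\<close> edge-disjoint spanning trees if
  \<open>2k + 1 \<le> n\<close>. Instead of the Nash-Williams-Tutte theorem it needs only induction: for
  \<open>n > 2k + 1\<close>, removing an endvertex of a missing edge keeps the hypothesis and the vertex is put
  back as a leaf of every tree; for \<open>n = 2k + 1\<close>, two vertices and one tree are removed.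
\<close>

section \<open>Complete graphs, stars, trees and packings as edge sets\<close>

definition all_pairs :: "'a set \<Rightarrow> 'a set set" where
  "all_pairs V = {e. e \<subseteq> V \<and> card e = 2}"

definition star :: "'a \<Rightarrow> 'a set \<Rightarrow> 'a set set" where
  "star x A = (\<lambda>y. {x, y}) ` A"

text \<open>Trees in a form that suits explicit constructions; \<open>tree_on_is_tree\<close> and
  \<open>connected_contains_tree_on\<close> connect it with \<open>is_tree\<close>.\<close>

inductive tree_on :: "'a set \<Rightarrow> 'a set set \<Rightarrow> bool" where
  singleton: "tree_on {v} {}"
| leaf: "tree_on V E \<Longrightarrow> u \<in> V \<Longrightarrow> v \<notin> V \<Longrightarrow> tree_on (insert v V) (insert {u, v} E)"

text \<open>An indexed family, so that each tree can be altered separately. On a single vertex all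
  \<open>F i\<close> are empty and coincide; from two vertices on, disjointness makes the trees
  distinct.\<close>

definition tree_packing :: "'a set \<Rightarrow> 'a set set \<Rightarrow> nat \<Rightarrow> bool" where
  "tree_packing V E k \<longleftrightarrow> (\<exists>F. (\<forall>i<k. tree_on V (F i) \<and> F i \<subseteq> E) \<and>
     (\<forall>i<k. \<forall>j<k. i \<noteq> j \<longrightarrow> F i \<inter> F j = {}))"

section \<open>Trees grown leaf by leaf\<close>

lemma finite_all_pairs: "finite V \<Longrightarrow> finite (all_pairs V)"
  unfolding all_pairs_def by (rule finite_subset[of _ "Pow V"]) auto

lemma card_all_pairs: "finite V \<Longrightarrow> card (all_pairs V) = card V choose 2"
  unfolding all_pairs_def by (rule n_subsets)

lemma doubleton_in_all_pairs [simp]: "{x, y} \<in> all_pairs V \<longleftrightarrow> x \<in> V \<and> y \<in> V \<and> x \<noteq> y"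
  by (auto simp: all_pairs_def card_insert_if)

lemma card_star: "card (star x A) = card A"
  unfolding star_def by (rule card_image) (auto simp: inj_on_def doubleton_eq_iff)

lemma finite_star [simp]: "finite A \<Longrightarrow> finite (star x A)"
  by (simp add: star_def)

lemma tree_on_finite: "tree_on V E \<Longrightarrow> finite V \<and> finite E"
  by (induction rule: tree_on.induct) auto

lemma tree_on_subset_all_pairs: "tree_on V E \<Longrightarrow> E \<subseteq> all_pairs V"
  by (induction rule: tree_on.induct) (auto simp: all_pairs_def card_insert_if)

lemma tree_on_card: "tree_on V E \<Longrightarrow> card V = Suc (card E)"
proof (induction rule: tree_on.induct)
  case (leaf V E u v)
  have "{u, v} \<notin> E"
    using tree_on_subset_all_pairs[OF leaf(1)] leaf(3) by (auto simp: all_pairs_def)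
  then show ?case
    using leaf tree_on_finite[OF leaf(1)] by simp
qed simp

lemma tree_on_star:
  assumes "finite C" "tree_on V E" "u \<in> V" "V \<inter> C = {}"
  shows "tree_on (V \<union> C) (E \<union> star u C)"
  using assms
proof (induction C rule: finite_induct)
  case (insert c C)
  then have "tree_on (insert c (V \<union> C)) (insert {u, c} (E \<union> star u C))"
    by (intro tree_on.leaf) auto
  then show ?case by (simp add: star_def)
qed (simp add: star_def)

lemma tree_on_connected:
  assumes "tree_on V E"
  shows "connected_graph \<lparr>verts = V, edges = E\<rparr>"
  using assms
proof (induction rule: tree_on.induct)
  case (singleton v)
  then show ?case by (simp add: connected_graph_def)
next
  case (leaf V E u v)
  let ?R = "{(x, y). {x, y} \<in> E}" and ?R' = "{(x, y). {x, y} \<in> insert {u, v} E}"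
  have sub: "?R\<^sup>* \<subseteq> ?R'\<^sup>*" by (rule rtrancl_mono) auto
  have uv: "(u, v) \<in> ?R'\<^sup>*" "(v, u) \<in> ?R'\<^sup>*" by (auto simp: insert_commute)
  have VV: "(x, y) \<in> ?R'\<^sup>*" if "x \<in> V" "y \<in> V" for x y
    using leaf.IH that sub unfolding connected_graph_def by auto
  have "(x, y) \<in> ?R'\<^sup>*" if "x \<in> insert v V" "y \<in> insert v V" for x y
    using that VV[of x y] VV[of x u] VV[of u y] uv leaf(2) by (auto intro: rtrancl_trans)
  then show ?case unfolding connected_graph_def by simp
qed

text \<open>A cycle through the newest leaf would enter and leave it along the same edge.\<close>

lemma tree_on_acyclic:
  assumes "tree_on V E"
  shows "\<not> is_cycle \<lparr>verts = V, edges = E\<rparr> vs"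
  using assms
proof (induction arbitrary: vs rule: tree_on.induct)
  case (singleton v)
  show ?case
  proof
    assume "is_cycle \<lparr>verts = {v}, edges = {}\<rparr> vs"
    then have "3 \<le> length vs" "\<forall>i<length vs. False" by (simp_all add: is_cycle_def)
    then show False by (metis gr_zeroI not_numeral_le_zero)
  qed
next
  case (leaf V E u v)
  show ?case
  proof
    assume "is_cycle \<lparr>verts = insert v V, edges = insert {u, v} E\<rparr> vs"
    then have len: "3 \<le> length vs" and dis: "distinct vs"
      and ed: "\<And>i. i < length vs \<Longrightarrow> {vs ! i, vs ! (Suc i mod length vs)} \<in> insert {u, v} E"
      by (auto simp: is_cycle_def)
    let ?n = "length vs"
    have EV: "e \<subseteq> V" if "e \<in> E" for e
      using tree_on_subset_all_pairs[OF leaf(1)] that by (auto simp: all_pairs_def)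
    have "v \<notin> set vs"
    proof
      assume "v \<in> set vs"
      then obtain i where i: "i < ?n" "vs ! i = v" by (auto simp: in_set_conv_nth)
      \<comment> \<open>The positions of the successor and the predecessor of \<open>v\<close> on
        the cycle; they differ because a cycle has at least three vertices.\<close>
      define a where "a = Suc i mod ?n"
      define b where "b = (if i = 0 then ?n - 1 else i - 1)"
      have ab: "a < ?n" "b < ?n" "Suc b mod ?n = i" "a \<noteq> b"
        using len i(1) unfolding a_def b_def
        by (auto simp: mod_Suc split: if_splits)
      have "{v, vs ! a} \<in> insert {u, v} E" "{vs ! b, v} \<in> insert {u, v} E"
        using ed[OF i(1)] ed[OF ab(2)] ab(3) i(2) a_def by auto
      then have "vs ! a = u" "vs ! b = u"
        using EV leaf(2,3) by (auto simp: doubleton_eq_iff)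
      then show False
        using dis ab by (metis nth_eq_iff_index_eq)
    qed
    have "{vs ! i, vs ! (Suc i mod ?n)} \<in> E" if "i < ?n" for i
    proof -
      have "vs ! i \<in> set vs" using that by simp
      moreover have "vs ! (Suc i mod ?n) \<in> set vs" using len by (intro nth_mem mod_less_divisor) linarith
      ultimately show ?thesis
        using ed[OF that] \<open>v \<notin> set vs\<close> by (auto simp: doubleton_eq_iff)
    qed
    then have "is_cycle \<lparr>verts = V, edges = E\<rparr> vs"
      using len dis by (simp add: is_cycle_def)
    then show False using leaf.IH by blast
  qed
qed

lemma tree_on_is_tree:
  assumes "tree_on V E"
  shows "is_tree \<lparr>verts = V, edges = E\<rparr>"
  using tree_on_finite[OF assms] tree_on_subset_all_pairs[OF assms] tree_on_connected[OF assms]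
    tree_on_acyclic[OF assms]
  by (auto simp: is_tree_def simple_graph_def all_pairs_def)

text \<open>The walk from \<open>u\<close> to \<open>x\<close> has to leave \<open>W\<close> at some
  step.\<close>

lemma connected_crossing_edge:
  assumes "connected_graph G" "W \<subseteq> verts G" "u \<in> W" "x \<in> verts G - W"
  obtains a b where "a \<in> W" "b \<notin> W" "{a, b} \<in> edges G"
proof -
  have "(u, x) \<in> {(x, y). {x, y} \<in> edges G}\<^sup>*"
    using assms unfolding connected_graph_def by auto
  then have "x \<notin> W \<Longrightarrow> \<exists>a b. a \<in> W \<and> b \<notin> W \<and> {a, b} \<in> edges G"
    using assms(3) by (induction rule: rtrancl_induct) blast+
  then show ?thesis using assms(4) that by blast
qed

text \<open>A tree is grown from one vertex: as long as it misses a vertex, some edge leaves its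
  vertex set and supplies the next leaf.\<close>

lemma connected_contains_tree_on:
  assumes "simple_graph G" "connected_graph G"
  obtains E where "tree_on (verts G) E" "E \<subseteq> edges G"
proof -
  have fin: "finite (verts G)" using assms(1) by (simp add: simple_graph_def)
  have "\<exists>W E. W \<subseteq> verts G \<and> E \<subseteq> edges G \<and> tree_on W E \<and> card W = Suc m" if "m < card (verts G)" for m
    using that
  proof (induction m)
    case 0
    obtain v where "v \<in> verts G" using assms(2) by (auto simp: connected_graph_def)
    then show ?case by (intro exI[of _ "{v}"] exI[of _ "{}"]) (auto intro: tree_on.singleton)
  next
    case (Suc m)
    then obtain W E where W: "W \<subseteq> verts G" "E \<subseteq> edges G" "tree_on W E" "card W = Suc m" by auto
    then obtain u where "u \<in> W" by fastforce
    moreover obtain x where "x \<in> verts G - W" using W(1,4) Suc.prems by (metis DiffI less_irrefl subsetI subset_antisym)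
    ultimately obtain a b where ab: "a \<in> W" "b \<notin> W" "{a, b} \<in> edges G"
      using connected_crossing_edge[OF assms(2) W(1)] by blast
    then have "b \<in> verts G" using assms(1) by (auto simp: simple_graph_def)
    then show ?case
      using W ab tree_on_finite[OF W(3)]
      by (intro exI[of _ "insert b W"] exI[of _ "insert {a, b} E"]) (auto intro: tree_on.leaf)
  qed
  from this[of "card (verts G) - 1"] obtain W E
    where W: "W \<subseteq> verts G" "E \<subseteq> edges G" "tree_on W E" "card W = Suc (card (verts G) - 1)"
    using assms(2) fin by (auto simp: connected_graph_def card_gt_0_iff)
  moreover have "card (verts G) > 0" using assms(2) fin by (auto simp: connected_graph_def card_gt_0_iff)
  ultimately have "W = verts G" using fin by (simp add: card_subset_eq)
  then show ?thesis using W that by blast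
qed

section \<open>Packing spanning trees into a nearly complete graph\<close>

lemma tree_packing_mono: "tree_packing V E k \<Longrightarrow> E \<subseteq> E' \<Longrightarrow> tree_packing V E' k"
  unfolding tree_packing_def by (elim ex_forward) auto

text \<open>Distinct trees receive distinct neighbours of \<open>v\<close>, which
  \<open>k \<le> card N\<close> makes possible. The new edges differ from each other and from all
  old tree edges, none of which contains \<open>v\<close>.\<close>

lemma tree_packing_leaf:
  assumes "tree_packing V E k" "v \<notin> V" "N \<subseteq> V" "k \<le> card N"
  shows "tree_packing (insert v V) (E \<union> star v N) k"
proof (cases "k = 0")
  case True
  then show ?thesis by (simp add: tree_packing_def)
next
  case False
  obtain F where "\<forall>i<k. tree_on V (F i) \<and> F i \<subseteq> E"
    "\<forall>i<k. \<forall>j<k. i \<noteq> j \<longrightarrow> F i \<inter> F j = {}"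
    using assms(1) unfolding tree_packing_def by (elim exE conjE)
  then have F: "\<And>i. i < k \<Longrightarrow> tree_on V (F i)" "\<And>i. i < k \<Longrightarrow> F i \<subseteq> E"
    "\<And>i j. i < k \<Longrightarrow> j < k \<Longrightarrow> i \<noteq> j \<Longrightarrow> F i \<inter> F j = {}"
    by simp_all
  \<comment> \<open>For \<open>k > 0\<close> the bound rules out an infinite \<open>N\<close>, whose
    \<open>card\<close> is 0.\<close>
  have "finite N" using False assms(4) by (metis card.infinite le_zero_eq)
  then obtain h where h: "inj_on h {..<k}" "h ` {..<k} \<subseteq> N"
    using assms(4) card_le_inj[of "{..<k}" N] by auto
  define F' where "F' i = insert {h i, v} (F i)" for i
  have vF: "{x, v} \<notin> F i" if "i < k" for i x
    using tree_on_subset_all_pairs[OF F(1)[OF that]] assms(2) by (auto simp: all_pairs_def)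
  have hN: "h i \<in> N" if "i < k" for i using h(2) that by auto
  have "tree_on (insert v V) (F' i) \<and> F' i \<subseteq> E \<union> star v N" if "i < k" for i
    using F(2)[OF that] hN[OF that] tree_on.leaf[OF F(1)[OF that], of "h i" v] assms(2,3)
    by (auto simp: F'_def star_def insert_commute)
  moreover have "F' i \<inter> F' j = {}" if "i < k" "j < k" "i \<noteq> j" for i j
  proof -
    have "h i \<noteq> h j" using h(1) that by (auto simp: inj_on_def)
    then have "{h i, v} \<noteq> {h j, v}" by (auto simp: doubleton_eq_iff)
    then show ?thesis
      using F(3)[OF that] vF[OF that(1)] vF[OF that(2)] by (auto simp: F'_def)
  qed
  ultimately show ?thesis unfolding tree_packing_def by blast
qed

lemma tree_packing_Suc:
  assumes "tree_packing V E k" "tree_on V T" "T \<inter> E = {}"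
  shows "tree_packing V (E \<union> T) (Suc k)"
proof -
  obtain F where "\<forall>i<k. tree_on V (F i) \<and> F i \<subseteq> E"
    "\<forall>i<k. \<forall>j<k. i \<noteq> j \<longrightarrow> F i \<inter> F j = {}"
    using assms(1) unfolding tree_packing_def by (elim exE conjE)
  then have F: "\<And>i. i < k \<Longrightarrow> tree_on V (F i)" "\<And>i. i < k \<Longrightarrow> F i \<subseteq> E"
    "\<And>i j. i < k \<Longrightarrow> j < k \<Longrightarrow> i \<noteq> j \<Longrightarrow> F i \<inter> F j = {}"
    by simp_all
  show ?thesis
    unfolding tree_packing_def
  proof (intro exI[of _ "F(k := T)"] conjI allI impI)
    fix i j assume "i < Suc k" "j < Suc k" "i \<noteq> j"
    then show "(F(k := T)) i \<inter> (F(k := T)) j = {}"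
      using F(2)[of i] F(2)[of j] F(3)[of i j] assms(3) by (auto simp: less_Suc_eq)
  qed (use F assms(2) in \<open>auto simp: less_Suc_eq\<close>)
qed

text \<open>Each edge covers two vertices. The bound serves to find vertices that lie on no missing
  edge.\<close>

lemma card_Union_pairs_le:
  assumes "finite M" "\<And>e. e \<in> M \<Longrightarrow> card e = 2"
  shows "card (\<Union>M) \<le> 2 * card M"
proof -
  have "card (\<Union>M) \<le> sum card M" by (rule card_Union_le_sum_card)
  also have "\<dots> = 2 * card M" using assms by simp
  finally show ?thesis .
qed

text \<open>The case in which the trees have to use every edge. Two vertices \<open>v\<close>, \<open>w\<close> are removed, where
  \<open>v\<close> is on no missing edge and \<open>w\<close> is on \<open>t \<ge> 1\<close> of them. The tree added to those obtained by
  induction consists of the edge \<open>vw\<close>, stars from \<open>v\<close> and \<open>w\<close> to sets \<open>A\<close> and \<open>B\<close> of sizes \<open>k\<close> and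
  \<open>k - t\<close>, and a star to the remaining \<open>t - 1\<close> vertices, the edges of which are declared missing
  in the smaller graph.\<close>

lemma tree_packing_tight:
  assumes "finite V" "card V = 2 * k + 1" "M \<subseteq> all_pairs V" "card M \<le> k"
  shows "tree_packing V (all_pairs V - M) k"
  using assms
proof (induction k arbitrary: V M)
  case 0
  then show ?case by (simp add: tree_packing_def)
next
  case (Suc k' V M0)
  define k where "k = Suc k'"
  have finP: "finite (all_pairs V)" using Suc.prems(1) by (rule finite_all_pairs)
  \<comment> \<open>Further missing edges only make the claim harder, so \<open>M0\<close> is
    enlarged to exactly \<open>k\<close> edges; there is room, as a star at one vertex has
    \<open>2 * k\<close> edges. The other \<open>2 * k * k\<close> edges are just enough for
    \<open>k\<close> trees.\<close>
  have "k \<le> card (all_pairs V)"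
  proof -
    have "card (star x (V - {x})) \<le> card (all_pairs V)" if "x \<in> V" for x
      by (rule card_mono[OF finP]) (use that in \<open>auto simp: star_def\<close>)
    moreover obtain x where "x \<in> V" using Suc.prems(2) by fastforce
    ultimately show ?thesis using Suc.prems(1,2) k_def by (force simp: card_star)
  qed
  then obtain M where M: "M0 \<subseteq> M" "M \<subseteq> all_pairs V" "card M = k"
    using exists_subset_between[OF _ _ Suc.prems(3) finP, of k] Suc.prems(4) k_def by auto
  have cV: "card V = 2 * k + 1" using Suc.prems k_def by simp
  have finM: "finite M" using M(2) finP finite_subset by blast
  have M2: "card e = 2" "e \<subseteq> V" if "e \<in> M" for e using M(2) that by (auto simp: all_pairs_def)
  have UM: "\<Union>M \<subseteq> V" using M2 by blast
  have finV: "finite V" by fact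
  \<comment> \<open>The \<open>k\<close> missing edges cover at most \<open>2 * k\<close> of the
    \<open>2 * k + 1\<close> vertices, which leaves one for \<open>v\<close>.\<close>
  have "card (\<Union>M) \<le> 2 * k" using card_Union_pairs_le[OF finM] M2 M(3) by simp
  then have "\<Union>M \<noteq> V" using cV by auto
  then obtain v where v: "v \<in> V" "v \<notin> \<Union>M" using UM by blast
  obtain e where e: "e \<in> M" using M(3) k_def by fastforce
  then obtain w x where wx: "e = {w, x}" "w \<noteq> x" using M2 by (meson card_2_iff)
  have w: "w \<in> V" "w \<noteq> v" and x: "x \<in> V" "x \<noteq> v" using e wx v UM by auto
  define V' where "V' = V - {v, w}"
  \<comment> \<open>The vertices joined to \<open>w\<close> by a missing edge; restricting to
    \<open>V'\<close> loses none, as \<open>v\<close> lies on no missing edge.\<close>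
  define X where "X = {y \<in> V'. {w, y} \<in> M}"
  define t where "t = card X"
  have xX: "x \<in> X" using x wx e by (simp add: X_def V'_def)
  have finV': "finite V'" and finX: "finite X" using finV by (auto simp: V'_def X_def)
  have cV': "card V' = 2 * k - 1" using cV finV v w by (simp add: V'_def card_Diff_subset)
  have t1: "1 \<le> t" using xX finX by (auto simp: t_def Suc_le_eq card_gt_0_iff)
  have starX: "star w X \<subseteq> M" by (auto simp: star_def X_def)
  have tk: "t \<le> k" using card_mono[OF finM starX] M(3) by (simp add: card_star t_def)
  \<comment> \<open>The missing edges that survive in \<open>V'\<close>. There are
    \<open>k - t\<close> of them, so the induction hypothesis for \<open>k' = k - 1\<close> permits
    another \<open>t - 1\<close>.\<close>
  define M1 where "M1 = {e \<in> M. w \<notin> e}"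
  have Msplit: "M = M1 \<union> star w X" "M1 \<inter> star w X = {}"
  proof -
    have "e \<in> star w X" if e: "e \<in> M" "w \<in> e" for e
    proof -
      obtain a b where ab: "e = {a, b}" "a \<noteq> b" using M2(1)[OF e(1)] by (meson card_2_iff)
      then obtain y where y: "e = {w, y}" "w \<noteq> y" using e(2) by auto
      then have "y \<in> X" using e(1) M2(2)[OF e(1)] v(2) by (auto simp: X_def V'_def)
      then show ?thesis using y by (auto simp: star_def)
    qed
    then show "M = M1 \<union> star w X" using starX by (auto simp: M1_def)
    show "M1 \<inter> star w X = {}" by (auto simp: M1_def star_def)
  qed
  have cM1: "card M1 = k - t"
  proof -
    have "card M = card M1 + card (star w X)"
      by (subst Msplit(1), rule card_Un_disjoint) (use finM finX Msplit(2) in \<open>auto simp: M1_def\<close>)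
    then show ?thesis using M(3) by (simp add: card_star t_def)
  qed
  have M1V': "M1 \<subseteq> all_pairs V'" using M(2) v(2) by (auto simp: M1_def V'_def all_pairs_def)
  \<comment> \<open>The centre of the star to \<open>C\<close>, so no missing edge may join it to
    \<open>C\<close>. For \<open>t = 1\<close> the set \<open>C\<close> will be empty and
    \<open>x\<close> will do. For \<open>t \<ge> 2\<close> a vertex on no missing edge is left over:
    the ends of \<open>M1\<close> together with \<open>w\<close>, \<open>X\<close> and
    \<open>v\<close> are at most \<open>2 * (k - t) + t + 2 \<le> 2 * k\<close> vertices.\<close>
  obtain u where u: "u \<in> V'" "t = 1 \<and> u = x \<or> 2 \<le> t \<and> u \<notin> \<Union>M"
  proof (cases "t = 1")
    case True
    then show ?thesis using that xX by (auto simp: X_def)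
  next
    case False
    have "\<Union>M \<subseteq> \<Union>M1 \<union> insert w X" by (subst Msplit(1)) (auto simp: star_def)
    then have "card (\<Union>M) \<le> card (\<Union>M1 \<union> insert w X)"
      by (intro card_mono finite_UnI) (use UM finV finX in \<open>auto simp: M1_def intro: rev_finite_subset\<close>)
    also have "\<dots> \<le> card (\<Union>M1) + card (insert w X)" by (rule card_Un_le)
    also have "\<dots> \<le> 2 * (k - t) + Suc t"
      using card_Union_pairs_le[of M1] M2 finM cM1 finX
      by (intro add_mono) (auto simp: M1_def t_def card_insert_if)
    finally have "card (insert v (\<Union>M)) < card V"
      using False t1 tk cV v(2) rev_finite_subset[OF finV UM] by simp
    then have "insert v (\<Union>M) \<noteq> V" by auto
    then obtain u where "u \<in> V" "u \<notin> insert v (\<Union>M)" using UM v(1) by blast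
    moreover have "w \<in> \<Union>M" using e wx by auto
    ultimately show ?thesis using that[of u] False t1 by (auto simp: V'_def)
  qed
  \<comment> \<open>\<open>u \<in> A\<close> puts \<open>u\<close> into the tree before
    \<open>C\<close> is attached to it. \<open>x \<in> A \<inter> X\<close> makes
    \<open>A \<union> X\<close> small enough to leave \<open>k - t\<close> vertices for
    \<open>B\<close>, which avoids \<open>X\<close> so that no edge from \<open>w\<close> to
    \<open>B\<close> is missing.\<close>
  have "card {u, x} \<le> k" using u(2) tk t1 by (auto simp: card_insert_if)
  then obtain A where A: "{u, x} \<subseteq> A" "A \<subseteq> V'" "card A = k"
    using exists_subset_between[of "{u, x}" k V'] u(1) xX finV' cV' k_def by (auto simp: X_def)
  have finA: "finite A" using A(2) finV' finite_subset by blast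
  have "k - t \<le> card (V' - A - X)"
  proof -
    have "card (A \<union> X) + card (A \<inter> X) = k + t"
      using card_Un_Int[OF finA finX] A(3) by (simp add: t_def)
    moreover have "card (A \<inter> X) \<ge> 1"
      using A(1) xX finA by (auto simp: Suc_le_eq card_gt_0_iff)
    moreover have "card (V' - (A \<union> X)) = card V' - card (A \<union> X)"
      by (rule card_Diff_subset) (use finA finX A(2) in \<open>auto simp: X_def\<close>)
    moreover have "V' - A - X = V' - (A \<union> X)" by auto
    ultimately show ?thesis using cV' tk by simp
  qed
  then obtain B where B: "B \<subseteq> V' - A - X" "card B = k - t" "finite B"
    by (rule obtain_subset_with_card_n)
  define C where "C = V' - A - B"
  have finC: "finite C" using finV' by (simp add: C_def)
  have cC: "card C = t - 1"
  proof -
    have "card (V' - (A \<union> B)) = card V' - card (A \<union> B)"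
      by (rule card_Diff_subset) (use finA B A(2) in auto)
    moreover have "card (A \<union> B) = k + (k - t)"
      using card_Un_disjoint[of A B] finA B A(3) by auto
    moreover have "C = V' - (A \<union> B)" by (auto simp: C_def)
    ultimately show ?thesis using cV' tk by simp
  qed
  have uC: "u \<notin> C" "C \<subseteq> V'" using A(1) by (auto simp: C_def)
  have CM: "star u C \<inter> M = {}"
    using u(2) cC finC by (auto simp: star_def)
  have CP: "star u C \<subseteq> all_pairs V'" using u(1) uC by (auto simp: star_def)
  define E0 where "E0 = all_pairs V' - (M1 \<union> star u C)"
  have "card (M1 \<union> star u C) \<le> k'"
    using card_Un_le[of M1 "star u C"] cM1 cC t1 tk k_def by (simp add: card_star)
  then have p0: "tree_packing V' E0 k'"
    unfolding E0_def using Suc.IH[OF finV'] cV' k_def M1V' CP by simp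
  have Vw: "V = insert w (insert v V')" and vV': "v \<notin> V'" "w \<notin> insert v V'"
    using v w by (auto simp: V'_def)
  \<comment> \<open>The edges into \<open>V'\<close> that are neither missing nor reserved for the
    new tree number exactly \<open>k - 1\<close> at \<open>v\<close> and, as shown below, at
    \<open>w\<close>. So both vertices can be put back as leaves of the \<open>k'\<close> old
    trees.\<close>
  have "card (V' - A) = k'"
    using A(2,3) finA cV' k_def by (simp add: card_Diff_subset)
  then have p1: "tree_packing (insert v V') (E0 \<union> star v (V' - A)) k'"
    by (intro tree_packing_leaf[OF p0 vV'(1)]) auto
  have "card (V' - (B \<union> X)) = k'"
  proof -
    have "card (V' - (B \<union> X)) = card V' - card (B \<union> X)"
      by (rule card_Diff_subset) (use B finX in \<open>auto simp: X_def\<close>)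
    moreover have "card (B \<union> X) = (k - t) + t"
      using card_Un_disjoint[of B X] B finX t_def by auto
    ultimately show ?thesis using cV' tk k_def by simp
  qed
  then have p2: "tree_packing V (E0 \<union> star v (V' - A) \<union> star w (V' - (B \<union> X))) k'"
    unfolding Vw by (intro tree_packing_leaf[OF p1 vV'(2)]) auto
  define T where "T = {{v, w}} \<union> star v A \<union> star w B \<union> star u C"
  have T: "tree_on V T"
  proof -
    have "tree_on {w, v} {{v, w}}"
      using tree_on.leaf[OF tree_on.singleton, of v v w] w by simp
    then have "tree_on ({w, v} \<union> A) ({{v, w}} \<union> star v A)"
      using A(2) by (intro tree_on_star[OF finA]) (auto simp: V'_def)
    then have "tree_on ({w, v} \<union> A \<union> B) ({{v, w}} \<union> star v A \<union> star w B)"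
      by (rule tree_on_star[OF B(3)]) (use B in \<open>auto simp: V'_def\<close>)
    then have "tree_on ({w, v} \<union> A \<union> B \<union> C) T"
      unfolding T_def by (rule tree_on_star[OF finC]) (use A(1) in \<open>auto simp: C_def V'_def\<close>)
    moreover have "{w, v} \<union> A \<union> B \<union> C = V" using A(2) B v w by (auto simp: C_def V'_def)
    ultimately show ?thesis by simp
  qed
  have E0V': "e \<subseteq> V'" if "e \<in> E0" for e using that by (auto simp: E0_def all_pairs_def)
  have vw': "v \<notin> V'" "w \<notin> V'" "v \<noteq> w" using vV' w by auto
  \<comment> \<open>Edges at \<open>v\<close> and at \<open>w\<close> are divided between
    \<open>T\<close> and the old trees by their other end, and \<open>star u C\<close> was taken out
    of \<open>E0\<close>.\<close>
  have "T \<inter> (E0 \<union> star v (V' - A) \<union> star w (V' - (B \<union> X))) = {}"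
  proof -
    have "T \<inter> E0 = {}"
      using vw' E0V' by (auto simp: T_def star_def E0_def)
    moreover have "T \<inter> star v (V' - A) = {}"
      using vw' A(2) B(1) u(1) uC(2) by (auto simp: T_def star_def doubleton_eq_iff)
    moreover have "T \<inter> star w (V' - (B \<union> X)) = {}"
      using vw' A(2) B(1) u(1) uC(2) by (auto simp: T_def star_def doubleton_eq_iff)
    ultimately show ?thesis by blast
  qed
  then have "tree_packing V (E0 \<union> star v (V' - A) \<union> star w (V' - (B \<union> X)) \<union> T) k"
    unfolding k_def by (rule tree_packing_Suc[OF p2 T])
  moreover have "E0 \<union> star v (V' - A) \<union> star w (V' - (B \<union> X)) \<union> T \<subseteq> all_pairs V - M"
  proof -
    have "E0 \<subseteq> all_pairs V" by (auto simp: E0_def V'_def all_pairs_def)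
    moreover have "E0 \<inter> M = {}"
      using Msplit(1) E0V' vw'(2) by (auto simp: E0_def star_def)
    moreover have "star v Y \<inter> M = {}" for Y using v(2) by (auto simp: star_def)
    moreover have "star v Y \<subseteq> all_pairs V" "star w Y \<subseteq> all_pairs V" if "Y \<subseteq> V'" for Y
      using that v w vw' by (auto simp: star_def V'_def)
    moreover have "star w Y \<inter> M = {}" if "Y \<subseteq> V' - X" for Y
      using that by (auto simp: star_def X_def)
    moreover have "{v, w} \<notin> M" using v(2) by auto
    moreover have "star u C \<subseteq> all_pairs V" using CP by (auto simp: V'_def all_pairs_def)
    moreover have "{v, w} \<in> all_pairs V" using v w by simp
    moreover have "B \<subseteq> V' - X" "B \<subseteq> V'" "V' - (B \<union> X) \<subseteq> V' - X" "V' - (B \<union> X) \<subseteq> V'" "V' - A \<subseteq> V'"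
      using B by auto
    ultimately show ?thesis
      unfolding T_def using CM A(2) by (simp add: Un_subset_iff Diff_eq disjoint_eq_subset_Compl)
  qed
  ultimately have "tree_packing V (all_pairs V - M) k" by (rule tree_packing_mono)
  then show ?case
    unfolding k_def by (rule tree_packing_mono) (use M(1) in auto)
qed

text \<open>Deleting an endvertex of a missing edge lowers \<open>card V\<close> by one and
  \<open>card M\<close> by at least one, so the last hypothesis survives down to
  \<open>card V = 2 * k + 1\<close>, where it reads \<open>card M \<le> k\<close>.\<close>

lemma tree_packing_nearly_complete:
  assumes "finite V" "2 * k + 1 \<le> card V" "M \<subseteq> all_pairs V" "card M + k + 1 \<le> card V"
  shows "tree_packing V (all_pairs V - M) k"
  using assms
proof (induction "card V" arbitrary: V M)
  case 0
  then show ?case by simp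
next
  case (Suc n V M)
  show ?case
  proof (cases "card V = 2 * k + 1")
    case True
    then show ?thesis using Suc.prems by (intro tree_packing_tight) auto
  next
    case False
    then have kn: "2 * k + 1 \<le> n" using Suc by simp
    have finM: "finite M" using Suc.prems(1,3) finite_all_pairs finite_subset by blast
    obtain v where v: "v \<in> V" "M = {} \<or> v \<in> \<Union>M"
    proof (cases "M = {}")
      case True
      then show ?thesis using that Suc.hyps(2) by fastforce
    next
      case False
      then obtain e where "e \<in> M" by blast
      moreover from this have "e \<subseteq> V" "e \<noteq> {}" using Suc.prems(3) by (auto simp: all_pairs_def)
      ultimately show ?thesis using that by blast
    qed
    define V' where "V' = V - {v}"
    define M' where "M' = {e \<in> M. v \<notin> e}"
    define N where "N = {x \<in> V'. {v, x} \<notin> M}"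
    have V': "finite V'" "card V' = n" "v \<notin> V'" "V = insert v V'"
      using Suc v by (auto simp: V'_def)
    \<comment> \<open>If no edge is missing, \<open>card M\<close> cannot drop, but then
      \<open>2 * k + 1 \<le> n\<close> suffices.\<close>
    have "card M' + k + 1 \<le> n"
    proof (cases "M = {}")
      case True
      then show ?thesis using kn by (simp add: M'_def)
    next
      case False
      then have "M' \<subset> M" using v(2) by (auto simp: M'_def)
      then have "card M' < card M" using finM by (simp add: psubset_card_mono)
      then show ?thesis using Suc by simp
    qed
    then have "tree_packing V' (all_pairs V' - M') k"
      using Suc.hyps(1)[of V' M'] V' kn Suc.prems(3)
      by (auto simp: M'_def all_pairs_def)
    \<comment> \<open>At most \<open>card M \<le> n - k\<close> of the \<open>n\<close> other
      vertices are not adjacent to \<open>v\<close>.\<close>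
    moreover have "k \<le> card N"
    proof -
      have "card (V' - N) = card (star v (V' - N))" by (simp add: card_star)
      also have "\<dots> \<le> card M"
        by (rule card_mono[OF finM]) (auto simp: star_def N_def)
      finally have "card (V' - N) \<le> card M" .
      moreover have "card (V' - N) = n - card N"
        using V' by (subst card_Diff_subset) (auto simp: N_def)
      ultimately show ?thesis using Suc by linarith
    qed
    ultimately have "tree_packing V ((all_pairs V' - M') \<union> star v N) k"
      unfolding V'(4) by (intro tree_packing_leaf) (use V'(3) in \<open>auto simp: N_def\<close>)
    then show ?thesis
      by (rule tree_packing_mono) (use v in \<open>auto simp: M'_def N_def V'_def star_def all_pairs_def\<close>)
  qed
qed

text \<open>Without \<open>v\<close>, and with a star of \<open>k\<close> edges from
  \<open>u\<close> to \<open>C\<close> declared missing, the tight case gives \<open>k\<close>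
  trees. Each takes \<open>v\<close> as a leaf through \<open>C\<close>; the other edges at
  \<open>v\<close> and the reserved star form the last tree.\<close>

lemma tree_packing_complete_even:
  assumes "finite V" "card V = 2 * Suc k"
  shows "tree_packing V (all_pairs V) (Suc k)"
proof -
  have "V \<noteq> {}" using assms by auto
  then obtain v where v: "v \<in> V" by blast
  define V' where "V' = V - {v}"
  have V': "finite V'" "card V' = 2 * k + 1" "v \<notin> V'" "V = insert v V'"
    using assms v by (auto simp: V'_def)
  have "V' \<noteq> {}" using V'(2) by auto
  then obtain u where u: "u \<in> V'" by blast
  have "k \<le> card (V' - {u})" using V' u by simp
  then obtain C where C: "C \<subseteq> V' - {u}" "card C = k" "finite C" by (rule obtain_subset_with_card_n)
  define A where "A = V' - C"
  have CP: "star u C \<subseteq> all_pairs V'" using C u by (auto simp: star_def)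
  have "tree_packing V' (all_pairs V' - star u C) k"
    using tree_packing_tight[OF V'(1,2) CP] C by (simp add: card_star)
  then have p: "tree_packing V ((all_pairs V' - star u C) \<union> star v C) k"
    unfolding V'(4) by (rule tree_packing_leaf) (use V' C in auto)
  have "tree_on ({v} \<union> A) ({} \<union> star v A)"
    by (rule tree_on_star) (use V' in \<open>auto simp: A_def intro: tree_on.singleton\<close>)
  then have "tree_on ({v} \<union> A \<union> C) ({} \<union> star v A \<union> star u C)"
    by (rule tree_on_star[rotated]) (use V' C u in \<open>auto simp: A_def\<close>)
  moreover have "{v} \<union> A \<union> C = V" using C V'(4) by (auto simp: A_def)
  ultimately have T: "tree_on V (star v A \<union> star u C)" by simp
  have "(star v A \<union> star u C) \<inter> ((all_pairs V' - star u C) \<union> star v C) = {}"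
    using V'(3) C u by (auto simp: star_def A_def doubleton_eq_iff)
  note packing = tree_packing_Suc[OF p T this]
  have "all_pairs V' \<subseteq> all_pairs V" by (auto simp: V'_def all_pairs_def)
  moreover have "star v Y \<subseteq> all_pairs V" if "Y \<subseteq> V'" for Y
    using that v by (auto simp: star_def V'_def)
  moreover have "C \<subseteq> V'" "A \<subseteq> V'" using C by (auto simp: A_def)
  ultimately have "(all_pairs V' - star u C) \<union> star v C \<union> (star v A \<union> star u C) \<subseteq> all_pairs V"
    using CP by (simp add: le_infI1 Diff_eq)
  then show ?thesis by (rule tree_packing_mono[OF packing])
qed

section \<open>Spanning trees and the invariant for \<open>k = n\<close>\<close>

lemma simple_graph_edges: "simple_graph G \<Longrightarrow> edges G \<subseteq> all_pairs (verts G)"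
  by (auto simp: simple_graph_def all_pairs_def)

lemma finite_edges: "simple_graph G \<Longrightarrow> finite (edges G)"
  by (rule finite_subset[OF simple_graph_edges]) (auto simp: simple_graph_def finite_all_pairs)

lemma spanning_tree_verts: "T \<in> trees_connecting G (verts G) \<Longrightarrow> verts T = verts G"
  by (auto simp: trees_connecting_def is_subgraph_def)

text \<open>Trees connecting the whole vertex set are spanning, so the condition on common vertices
  holds automatically.\<close>

lemma kappa_eq_lambda: "kappa G (verts G) = lambda G (verts G)"
proof -
  have eq: "internally_disjoint (verts G) T T' \<longleftrightarrow> edge_disjoint T T'"
    if "T \<in> trees_connecting G (verts G)" "T' \<in> trees_connecting G (verts G)" for T T'
    using that[THEN spanning_tree_verts] by (simp add: internally_disjoint_def edge_disjoint_def)
  have "pairwise (internally_disjoint (verts G)) \<T> \<longleftrightarrow> pairwise edge_disjoint \<T>"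
    if "\<T> \<subseteq> trees_connecting G (verts G)" for \<T>
    unfolding pairwise_def using that eq by blast
  then show ?thesis by (simp add: kappa_def lambda_def cong: conj_cong)
qed

text \<open>The maximum over \<open>S\<close> has a single term, the whole vertex set.\<close>

lemma bar_order_eq:
  assumes "simple_graph G" "card (verts G) = n"
  shows "kappa_bar n G = kappa G (verts G)" "lambda_bar n G = lambda G (verts G)"
proof -
  have "S = verts G" if "S \<subseteq> verts G" "card S = n" for S
    using that assms card_subset_eq by (metis simple_graph_def)
  then have "{F S | S. S \<subseteq> verts G \<and> card S = n} = {F (verts G)}" for F :: "'a set \<Rightarrow> nat"
    using assms(2) by auto
  then show "kappa_bar n G = kappa G (verts G)" "lambda_bar n G = lambda G (verts G)"
    unfolding kappa_bar_def lambda_bar_def by simp_all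
qed

lemma f_max_eq_g_max: "f_max n n l = g_max n n l"
proof -
  have "kappa_bar n G = lambda_bar n G" if "simple_graph G" "card (verts G) = n" for G :: "nat ugraph"
    using bar_order_eq[OF that] kappa_eq_lambda by metis
  then show ?thesis by (simp add: f_max_def g_max_def cong: conj_cong)
qed

section \<open>Lower and upper bounds for the number of edge-disjoint spanning trees\<close>

lemma tree_packing_le_lambda:
  assumes G: "simple_graph G" and "2 \<le> card (verts G)" and P: "tree_packing (verts G) (edges G) k"
  shows "k \<le> lambda G (verts G)"
proof -
  obtain F where "\<forall>i<k. tree_on (verts G) (F i) \<and> F i \<subseteq> edges G"
    "\<forall>i<k. \<forall>j<k. i \<noteq> j \<longrightarrow> F i \<inter> F j = {}"
    using P unfolding tree_packing_def by (elim exE conjE)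
  then have F: "\<And>i. i < k \<Longrightarrow> tree_on (verts G) (F i)" "\<And>i. i < k \<Longrightarrow> F i \<subseteq> edges G"
    "\<And>i j. i < k \<Longrightarrow> j < k \<Longrightarrow> i \<noteq> j \<Longrightarrow> F i \<inter> F j = {}"
    by simp_all
  define t where "t i = \<lparr>verts = verts G, edges = F i\<rparr>" for i
  \<comment> \<open>Nonempty disjoint edge sets are distinct, so the indexed family becomes a set of
    \<open>k\<close> trees.\<close>
  have "F i \<noteq> {}" if "i < k" for i
    using tree_on_card[OF F(1)[OF that]] assms(2) by auto
  then have inj: "inj_on t {..<k}"
    using F(3) by (fastforce simp: inj_on_def t_def)
  have "t i \<in> trees_connecting G (verts G)" if "i < k" for i
    using F(2)[OF that] tree_on_is_tree[OF F(1)[OF that]]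
    by (auto simp: trees_connecting_def is_subgraph_def t_def is_tree_def)
  moreover have "pairwise edge_disjoint (t ` {..<k})"
    using F(3) by (fastforce simp: pairwise_def edge_disjoint_def t_def)
  ultimately have "card (t ` {..<k}) \<in> {card \<T> | \<T>. \<T> \<subseteq> trees_connecting G (verts G) \<and> pairwise edge_disjoint \<T>}"
    by blast
  then have "card (t ` {..<k}) \<le> lambda G (verts G)"
    unfolding lambda_def by (rule Max_ge[OF packing_sizes_finite_nonempty(1)[OF G]])
  then show ?thesis using card_image[OF inj] by simp
qed

text \<open>Double counting: edge-disjoint trees use disjoint parts of \<open>D\<close>, each of
  size at least \<open>c\<close>. It is applied to all edges and to the edges at one vertex.\<close>

lemma lambda_mult_le:
  assumes G: "simple_graph G" and D: "finite D"
    and c: "\<And>T. T \<in> trees_connecting G (verts G) \<Longrightarrow> c \<le> card (edges T \<inter> D)"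
  shows "lambda G (verts G) * c \<le> card D"
proof -
  have "lambda G (verts G) \<in> {card \<T> | \<T>. \<T> \<subseteq> trees_connecting G (verts G) \<and> pairwise edge_disjoint \<T>}"
    unfolding lambda_def by (rule Max_in[OF packing_sizes_finite_nonempty[OF G]])
  then obtain \<T> where \<T>: "lambda G (verts G) = card \<T>" "\<T> \<subseteq> trees_connecting G (verts G)"
    "pairwise edge_disjoint \<T>" by blast
  have fin: "finite \<T>" using \<T>(2) finite_trees_connecting[OF G] finite_subset by blast
  have "card \<T> * c \<le> (\<Sum>T\<in>\<T>. card (edges T \<inter> D))"
    using sum_bounded_below[of \<T> c "\<lambda>T. card (edges T \<inter> D)"] c \<T>(2) by auto
  also have "\<dots> = card (\<Union>T\<in>\<T>. edges T \<inter> D)"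
    by (rule card_UN_disjoint[symmetric])
      (use fin D \<T>(3) in \<open>auto simp: pairwise_def edge_disjoint_def\<close>)
  also have "\<dots> \<le> card D" by (rule card_mono) (use D in auto)
  finally show ?thesis using \<T>(1) by simp
qed

text \<open>Being connected, \<open>T\<close> contains a tree grown leaf by leaf on the same
  vertices, whose edge count is known.\<close>

lemma spanning_tree_card_edges:
  assumes "T \<in> trees_connecting G (verts G)"
  shows "card (verts G) - 1 \<le> card (edges T)"
proof -
  have T: "simple_graph T" "connected_graph T"
    using assms by (auto simp: trees_connecting_def is_tree_def)
  obtain E where E: "tree_on (verts T) E" "E \<subseteq> edges T"
    by (rule connected_contains_tree_on[OF T])
  have "card E \<le> card (edges T)" by (rule card_mono[OF finite_edges[OF T(1)] E(2)])
  then show ?thesis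
    using tree_on_card[OF E(1)] spanning_tree_verts[OF assms] by simp
qed

lemma lambda_le_edge_count:
  assumes "simple_graph G"
  shows "lambda G (verts G) * (card (verts G) - 1) \<le> card (edges G)"
proof (rule lambda_mult_le[OF assms finite_edges[OF assms]])
  fix T assume T: "T \<in> trees_connecting G (verts G)"
  then have "edges T \<inter> edges G = edges T" by (auto simp: trees_connecting_def is_subgraph_def)
  then show "card (verts G) - 1 \<le> card (edges T \<inter> edges G)"
    using spanning_tree_card_edges[OF T] by simp
qed

text \<open>Every spanning tree has an edge leaving \<open>{v}\<close>; the second vertex
  \<open>u\<close> guarantees that there is something to reach.\<close>

lemma lambda_le_degree:
  assumes G: "simple_graph G" and v: "v \<in> verts G" and u: "u \<in> verts G" "u \<noteq> v"
  shows "lambda G (verts G) \<le> card {e \<in> edges G. v \<in> e}"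
proof -
  have "lambda G (verts G) * 1 \<le> card {e \<in> edges G. v \<in> e}"
  proof (rule lambda_mult_le[OF G])
    show fin: "finite {e \<in> edges G. v \<in> e}" using finite_edges[OF G] by simp
    fix T assume T: "T \<in> trees_connecting G (verts G)"
    then have "connected_graph T" "edges T \<subseteq> edges G"
      by (auto simp: trees_connecting_def is_tree_def is_subgraph_def)
    moreover have "{v} \<subseteq> verts T" "v \<in> {v}" "u \<in> verts T - {v}"
      using v u spanning_tree_verts[OF T] by auto
    ultimately obtain a b where "a \<in> {v}" "{a, b} \<in> edges T"
      by (metis connected_crossing_edge)
    then have "{v, b} \<in> edges T \<inter> {e \<in> edges G. v \<in> e}" using \<open>edges T \<subseteq> edges G\<close> by auto
    then show "1 \<le> card (edges T \<inter> {e \<in> edges G. v \<in> e})"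
      using fin by (auto simp: Suc_le_eq card_gt_0_iff)
  qed
  then show ?thesis by simp
qed

section \<open>The extremal number\<close>

lemma g_max_eqI:
  fixes H :: "nat ugraph"
  assumes H: "simple_graph H" "card (verts H) = n" "lambda H (verts H) \<le> l" "card (edges H) = m"
    and ub: "\<And>G :: nat ugraph. simple_graph G \<Longrightarrow> card (verts G) = n \<Longrightarrow>
      lambda G (verts G) \<le> l \<Longrightarrow> card (edges G) \<le> m"
  shows "g_max n n l = m"
  unfolding g_max_def
proof (rule Max_eqI[OF edge_counts_finite])
  show "m \<in> {card (edges G) | G :: nat ugraph. simple_graph G \<and> card (verts G) = n \<and> lambda_bar n G \<le> l}"
    using H bar_order_eq(2)[OF H(1,2)] by auto
next
  fix c
  assume "c \<in> {card (edges G) | G :: nat ugraph. simple_graph G \<and> card (verts G) = n \<and> lambda_bar n G \<le> l}"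
  then obtain G :: "nat ugraph" where G: "c = card (edges G)" "simple_graph G" "card (verts G) = n"
    "lambda_bar n G \<le> l" by blast
  then show "c \<le> m" using ub[OF G(2,3)] bar_order_eq(2)[OF G(2,3)] by simp
qed

lemma choose_two_pred: "1 \<le> n \<Longrightarrow> n choose 2 = ((n - 1) choose 2) + (n - 1)"
  by (cases n) (simp_all add: numeral_2_eq_2)

lemma edges_le_choose_two: "simple_graph G \<Longrightarrow> card (edges G) \<le> card (verts G) choose 2"
  by (metis card_all_pairs card_mono finite_all_pairs simple_graph_def simple_graph_edges)

text \<open>With one edge more than claimed, at most \<open>n - l - 2\<close> edges are missing,
  which is what a packing of \<open>l + 1\<close> trees tolerates; \<open>2 * l + 3 \<le> n\<close>
  is its size condition.\<close>

lemma edge_bound_of_lambda: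
  fixes G :: "'a ugraph"
  assumes G: "simple_graph G" "card (verts G) = n" "lambda G (verts G) \<le> l" and l: "2 * l + 3 \<le> n"
  shows "card (edges G) \<le> ((n - 1) choose 2) + l"
proof (rule ccontr)
  assume "\<not> ?thesis"
  then have big: "((n - 1) choose 2) + l + 1 \<le> card (edges G)" by simp
  define M where "M = all_pairs (verts G) - edges G"
  have fin: "finite (verts G)" using G(1) by (simp add: simple_graph_def)
  have "card M = (n choose 2) - card (edges G)"
    unfolding M_def using G simple_graph_edges[OF G(1)] finite_edges[OF G(1)] card_all_pairs[OF fin]
    by (simp add: card_Diff_subset)
  then have "card M + Suc l + 1 \<le> n" using big choose_two_pred[of n] l by simp
  then have "tree_packing (verts G) (all_pairs (verts G) - M) (Suc l)"
    using l G(2) by (intro tree_packing_nearly_complete[OF fin]) (auto simp: M_def)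
  then have "tree_packing (verts G) (edges G) (Suc l)"
    by (rule tree_packing_mono) (auto simp: M_def)
  then have "Suc l \<le> lambda G (verts G)"
    using G l by (intro tree_packing_le_lambda) auto
  then show False using G(3) by simp
qed

text \<open>Extremal graph: a complete graph on \<open>n - 1\<close> vertices and one further vertex
  of degree \<open>l\<close>, which limits the number of spanning trees.\<close>

lemma g_max_small:
  assumes "2 * l + 3 \<le> n"
  shows "g_max n n l = ((n - 1) choose 2) + l"
proof -
  define H :: "nat ugraph" where
    "H = \<lparr>verts = {..<n}, edges = all_pairs {..<n - 1} \<union> star (n - 1) {..<l}\<rparr>"
  have H: "simple_graph H" "card (verts H) = n"
    using assms by (auto simp: H_def simple_graph_def all_pairs_def star_def card_insert_if)
  have disj: "all_pairs {..<n - 1} \<inter> star (n - 1) {..<l} = {}"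
    by (auto simp: star_def)
  have "lambda H (verts H) \<le> card {e \<in> edges H. n - 1 \<in> e}"
    by (rule lambda_le_degree[OF H(1), of _ 0]) (use assms in \<open>auto simp: H_def\<close>)
  also have "{e \<in> edges H. n - 1 \<in> e} = star (n - 1) {..<l}"
    by (auto simp: H_def star_def all_pairs_def)
  finally have "lambda H (verts H) \<le> l" by (simp add: card_star)
  moreover have "card (edges H) = ((n - 1) choose 2) + l"
    unfolding H_def using disj
    by (simp add: card_Un_disjoint finite_all_pairs card_all_pairs card_star)
  ultimately show ?thesis
    using g_max_eqI[OF H] edge_bound_of_lambda assms by blast
qed

text \<open>The value is \<open>(n choose 2) - 1\<close>. The complete graph has
  \<open>l + 1\<close> edge-disjoint spanning trees, which exhaust its edges, so deleting any one
  edge is enough to exclude \<open>l + 1\<close> trees.\<close>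

lemma g_max_even:
  assumes "n = 2 * l + 2" "1 \<le> l"
  shows "g_max n n l = ((n - 1) choose 2) + 2 * l"
proof -
  define H :: "nat ugraph" where "H = \<lparr>verts = {..<n}, edges = all_pairs {..<n} - {{0, 1}}\<rparr>"
  have H: "simple_graph H" "card (verts H) = n"
    by (auto simp: H_def simple_graph_def all_pairs_def)
  have m: "n choose 2 = Suc (((n - 1) choose 2) + 2 * l)"
    using choose_two_pred[of n] assms by simp
  have "{0, 1} \<in> all_pairs {..<n}" using assms by simp
  then have ce: "card (edges H) = ((n - 1) choose 2) + 2 * l"
    unfolding H_def using m by (simp add: finite_all_pairs card_all_pairs)
  \<comment> \<open>\<open>Suc l\<close> spanning trees need \<open>Suc l * (n - 1)\<close> edges,
    which is \<open>n choose 2\<close> and one more than \<open>H\<close> has.\<close>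
  have "2 * (n choose 2) = 2 * (l + 1) * (n - 1)"
    using assms(1) by (simp add: choose_two)
  then have "card (edges H) < Suc l * (n - 1)" using ce m by simp
  then have "lambda H (verts H) * (n - 1) < Suc l * (n - 1)"
    using lambda_le_edge_count[OF H(1)] H(2) by simp
  then have "lambda H (verts H) \<le> l" by (simp only: mult_less_cancel2 less_Suc_eq_le)
  then show ?thesis
  proof (rule g_max_eqI[OF H _ ce])
    fix G :: "nat ugraph"
    assume G: "simple_graph G" "card (verts G) = n" "lambda G (verts G) \<le> l"
    have fin: "finite (verts G)" using G(1) by (simp add: simple_graph_def)
    show "card (edges G) \<le> ((n - 1) choose 2) + 2 * l"
    proof (rule ccontr)
      assume "\<not> ?thesis"
      then have "card (edges G) = card (all_pairs (verts G))"
        using edges_le_choose_two[OF G(1)] m G(2) card_all_pairs[OF fin] by simp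
      then have "edges G = all_pairs (verts G)"
        by (intro card_subset_eq finite_all_pairs fin simple_graph_edges G(1))
      then have "tree_packing (verts G) (edges G) (Suc l)"
        using tree_packing_complete_even[OF fin, of l] G(2) assms(1) by simp
      then have "Suc l \<le> lambda G (verts G)"
        using G assms by (intro tree_packing_le_lambda) auto
      then show False using G(3) by simp
    qed
  qed
qed

text \<open>The complete graph itself is admissible: each spanning tree takes \<open>n - 1\<close>
  of its \<open>n * (n - 1) / 2\<close> edges, so there are at most \<open>n div 2\<close> of
  them.\<close>

lemma g_max_top:
  assumes "l = n div 2" "2 \<le> n"
  shows "g_max n n l = n choose 2"
proof -
  define H :: "nat ugraph" where "H = \<lparr>verts = {..<n}, edges = all_pairs {..<n}\<rparr>"
  have H: "simple_graph H" "card (verts H) = n" "card (edges H) = n choose 2"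
    by (auto simp: H_def simple_graph_def all_pairs_def n_subsets)
  have "lambda H (verts H) * (n - 1) * 2 \<le> (n choose 2) * 2"
    using lambda_le_edge_count[OF H(1)] H by simp
  also have "\<dots> \<le> n * (n - 1)" by (simp add: choose_two)
  finally have "2 * lambda H (verts H) * (n - 1) \<le> n * (n - 1)" by (simp add: ac_simps)
  then have "lambda H (verts H) \<le> l" using assms by simp
  then show ?thesis
    using g_max_eqI[OF H(1,2) _ H(3)] edges_le_choose_two by metis
qed

theorem corollary2:
  fixes n l :: nat
  assumes "n \<ge> 6" and "1 \<le> l" and "l \<le> n div 2"
  shows "f_max n n l = g_max n n l \<and>
    ((1 \<le> l \<and> l \<le> (n - 4) div 2) \<or> (l = (n - 2) div 2 \<and> odd n)
       \<longrightarrow> g_max n n l = ((n - 1) choose 2) + l) \<and>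
    (l = (n - 2) div 2 \<and> even n \<longrightarrow> g_max n n l = ((n - 1) choose 2) + 2 * l) \<and>
    (l = n div 2 \<longrightarrow> g_max n n l = (n choose 2))"
proof (intro conjI impI)
  show "f_max n n l = g_max n n l" by (rule f_max_eq_g_max)
next
  assume "(1 \<le> l \<and> l \<le> (n - 4) div 2) \<or> (l = (n - 2) div 2 \<and> odd n)"
  \<comment> \<open>The first alternative even gives \<open>2 * l + 4 \<le> n\<close>; for odd
    \<open>n\<close> the second one gives \<open>n = 2 * l + 3\<close>, the boundary case of the
    packing argument.\<close>
  then have "2 * l + 3 \<le> n" using assms(1) by (auto elim!: oddE)
  then show "g_max n n l = ((n - 1) choose 2) + l" by (rule g_max_small)
next
  assume "l = (n - 2) div 2 \<and> even n"
  then have "n = 2 * l + 2" using assms(1) by (auto elim!: evenE)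
  then show "g_max n n l = ((n - 1) choose 2) + 2 * l" using assms(2) by (rule g_max_even)
next
  assume "l = n div 2"
  then show "g_max n n l = (n choose 2)" using assms(1) by (intro g_max_top) auto
qed

end
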